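(* Let $A(\delta)$ be an $m\times n$ matrix and $b(\delta)$ an $m$-vector whose entries are polynomials of degree at most $D$ in $\delta\in\mathbb{R}$. If there exists $\epsilon>0$ such that for every $\delta\in(0,\epsilon)$ there exists $x_1(\delta)\in\mathbb{R}^n$ with $A(\delta)x_1(\delta)\ge b(\delta)$, then there exists a vector of rational functions $x(\delta)$ and $\epsilon'>0$ such that $A(\delta)x(\delta)\ge b(\delta)$ for all $\delta\in(0,\epsilon')$. Further, one can take $x(\delta)=A_J^+(\delta)b_J(\delta)$ for some subset $J\subseteq[m]$ of constraints, and the numerators and the least common multiple of the denominators of all entries of $x(\delta)$ have degree at most $2nD$.
   Context: For $J\subseteq[m]$, $A_J$ is the $|J|\times n$ matrix of rows of $A$ indexed by $J$, $b_J$ the corresponding subvector, and $M^+$ denotes the Moore–Penrose pseudoinverse of a matrix $M$. *)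

theory Defs
  imports
    "Jordan_Normal_Form.DL_Submatrix"
    "HOL-Computational_Algebra.Computational_Algebra"
    "HOL-Computational_Algebra.Field_as_Ring"
begin

definition eval_mat :: "real poly mat \<Rightarrow> real \<Rightarrow> real mat" where
  "eval_mat A \<delta> = map_mat (\<lambda>p. poly p \<delta>) A"

definition eval_vec :: "real poly vec \<Rightarrow> real \<Rightarrow> real vec" where
  "eval_vec b \<delta> = map_vec (\<lambda>p. poly p \<delta>) b"

definition row_submatrix :: "'a mat \<Rightarrow> nat set \<Rightarrow> 'a mat" where
  "row_submatrix A J = submatrix A J UNIV"

text \<open>The entries are listed in increasing order of their indices, as in \<^const>\<open>submatrix\<close>.\<close>

definition subvec :: "'a vec \<Rightarrow> nat set \<Rightarrow> 'a vec" where
  "subvec b J = vec (card {i. i < dim_vec b \<and> i \<in> J}) (\<lambda>i. b $ pick J i)"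

text \<open>The four Penrose equations; over the reals the adjoint is the transpose.\<close>

definition is_pseudoinverse :: "real mat \<Rightarrow> real mat \<Rightarrow> bool" where
  "is_pseudoinverse M X \<longleftrightarrow>
     X \<in> carrier_mat (dim_col M) (dim_row M) \<and>
     M * X * M = M \<and>
     X * M * X = X \<and>
     transpose_mat (M * X) = M * X \<and>
     transpose_mat (X * M) = X * M"

definition pseudoinverse :: "real mat \<Rightarrow> real mat" where
  "pseudoinverse M = (THE X. is_pseudoinverse M X)"

lemma is_pseudoinverse_unique:
  assumes "is_pseudoinverse M X" and "is_pseudoinverse M Y"
  shows "X = Y"
proof -
  obtain r c where M: "M \<in> carrier_mat r c" by blast
  have X: "X \<in> carrier_mat c r" and Y: "Y \<in> carrier_mat c r"
    using assms M unfolding is_pseudoinverse_def by auto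
  note cX = assms(1)[unfolded is_pseudoinverse_def]
  note cY = assms(2)[unfolded is_pseudoinverse_def]
  have MX: "M * X \<in> carrier_mat r r" and MY: "M * Y \<in> carrier_mat r r"
    and XM: "X * M \<in> carrier_mat c c" and YM: "Y * M \<in> carrier_mat c c"
    using M X Y by auto
  have X1: "M * X * M = M" and X2: "X * M * X = X"
    and X3: "transpose_mat (M * X) = M * X" and X4: "transpose_mat (X * M) = X * M"
    using cX by blast+
  have Y1: "M * Y * M = M" and Y2: "Y * M * Y = Y"
    and Y3: "transpose_mat (M * Y) = M * Y" and Y4: "transpose_mat (Y * M) = Y * M"
    using cY by blast+
  have a: "M * Y * (M * X) = M * X"
    using assoc_mult_mat[OF MY M X] Y1 by simp
  have b: "M * X * (M * Y) = M * Y"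
    using assoc_mult_mat[OF MX M Y] X1 by simp
  have c: "X * M * (Y * M) = X * M"
    using assoc_mult_mat[OF X M YM] assoc_mult_mat[OF M Y M] Y1 by simp
  have d: "Y * M * (X * M) = Y * M"
    using assoc_mult_mat[OF Y M XM] assoc_mult_mat[OF M X M] X1 by simp
  have 1: "M * X = M * Y"
    using transpose_mult[OF MY MX] unfolding a b X3 Y3 .
  have 2: "X * M = Y * M"
    using transpose_mult[OF XM YM] unfolding c d X4 Y4 .
  have "X = Y * M * X" using X2 unfolding 2 by simp
  also have "\<dots> = Y * (M * X)" using assoc_mult_mat[OF Y M X] .
  also have "\<dots> = Y * M * Y" unfolding 1 using assoc_mult_mat[OF Y M Y] by simp
  finally show ?thesis unfolding Y2 .
qed

lemma pseudoinverse_eqI: "is_pseudoinverse M X \<Longrightarrow> pseudoinverse M = X"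
  unfolding pseudoinverse_def using is_pseudoinverse_unique by blast

text \<open>Numerator and denominator of a rational function in lowest terms, with monic denominator.\<close>

definition rat_num :: "real poly fract \<Rightarrow> real poly" where
  "rat_num r = fst (quot_of_fract r)"

definition rat_den :: "real poly fract \<Rightarrow> real poly" where
  "rat_den r = snd (quot_of_fract r)"

text \<open>At a pole this returns the junk value 0 of division by zero, so poles have to be
  excluded explicitly where the function is used.\<close>

definition rat_eval :: "real poly fract \<Rightarrow> real \<Rightarrow> real" where
  "rat_eval r \<delta> = poly (rat_num r) \<delta> / poly (rat_den r) \<delta>"

definition rat_eval_vec :: "real poly fract vec \<Rightarrow> real \<Rightarrow> real vec" where
  "rat_eval_vec x \<delta> = map_vec (\<lambda>r. rat_eval r \<delta>) x"

end

theory Submission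
  imports Defs "Jordan_Normal_Form.Char_Poly"
begin

text \<open>For a fixed \<open>\<delta>\<close>, take an inclusion-maximal set \<open>J\<close> of constraints with independent rows that
  are simultaneously tight at some feasible point. Then every solution of \<open>A\<^sub>J y = b\<^sub>J\<close> is feasible,
  in particular \<open>A\<^sub>J\<^sup>+ b\<^sub>J = A\<^sub>J\<^sup>T (A\<^sub>J A\<^sub>J\<^sup>T)\<^sup>-\<^sup>1 b\<^sub>J\<close>, and \<open>|J| \<le> n\<close>. By Cramer's rule this is a quotient of
  polynomials in \<open>\<delta>\<close> with common denominator \<open>det (A\<^sub>J A\<^sub>J\<^sup>T)\<close>; the entries of \<open>A\<^sub>J A\<^sub>J\<^sup>T\<close> have
  degree at most \<open>2D\<close>, which gives the degree bounds. For each \<open>J\<close>, whether this vector is defined and feasible depends only on signs of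
  polynomials in \<open>\<delta>\<close>, hence is constant for small \<open>\<delta> > 0\<close>. As there are finitely many \<open>J\<close> and
  each small \<open>\<delta>\<close> admits one, some \<open>J\<close> works for all small \<open>\<delta> > 0\<close>.\<close>

no_notation fps_nth (infixl "$" 75)

section \<open>Pseudoinverses of matrices with invertible Gram matrix\<close>

text \<open>With \<open>X\<close> the candidate, \<open>M * X\<close> is the identity, which settles
  three Penrose equations at once. The fourth, symmetry of \<open>X * M\<close>, needs
  \<open>H\<close> symmetric: transposing \<open>inv\<close> makes the transpose of \<open>H\<close>
  a left inverse of the symmetric Gram matrix, and left and right inverses agree.\<close>

lemma is_pseudoinverse_gram:
  assumes M: "M \<in> carrier_mat k n" and H: "H \<in> carrier_mat k k"
    and inv: "M * transpose_mat M * H = 1\<^sub>m k"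
  shows "is_pseudoinverse M (transpose_mat M * H)"
proof -
  let ?T = "transpose_mat M" and ?G = "M * transpose_mat M"
  have T: "?T \<in> carrier_mat n k" and G: "?G \<in> carrier_mat k k" using M by auto
  have Ht: "transpose_mat H \<in> carrier_mat k k" using H by simp
  have Gt: "transpose_mat ?G = ?G" using transpose_mult[OF M T] by simp
  have inv': "transpose_mat H * ?G = 1\<^sub>m k"
    using transpose_mult[OF G H] unfolding inv Gt by simp
  have "transpose_mat H = transpose_mat H * (?G * H)" using Ht inv by simp
  also have "\<dots> = H" using assoc_mult_mat[OF Ht G H] inv' H by simp
  finally have Hsym: "transpose_mat H = H" .
  have X: "?T * H \<in> carrier_mat n k" using T H by simp
  have MX: "M * (?T * H) = 1\<^sub>m k" using assoc_mult_mat[OF M T H] inv by simp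
  have XMX: "?T * H * M * (?T * H) = ?T * H"
    using assoc_mult_mat[OF X M X] unfolding MX right_mult_one_mat[OF X] .
  have "transpose_mat (?T * H * M) = ?T * transpose_mat (?T * H)"
    by (rule transpose_mult[OF X M])
  also have "\<dots> = ?T * (H * M)" using transpose_mult[OF T H] Hsym by simp
  also have "\<dots> = ?T * H * M" using assoc_mult_mat[OF T H M] by simp
  finally show ?thesis
    unfolding is_pseudoinverse_def using X M MX XMX by auto
qed

section \<open>Independent rows\<close>

text \<open>Coefficients are attached to row indices, not to the rows as a set of vectors, so that
  two equal rows count as dependent.\<close>

definition rows_indep :: "real mat \<Rightarrow> nat set \<Rightarrow> bool" where
  "rows_indep A J \<longleftrightarrow>
     (\<forall>c. (\<forall>j<dim_col A. (\<Sum>i\<in>J. c i * A $$ (i, j)) = 0) \<longrightarrow> (\<forall>i\<in>J. c i = 0))"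

lemma rows_indep_empty: "rows_indep A {}"
  by (simp add: rows_indep_def)

text \<open>The vector \<open>v\<close> certifies independence: pairing a vanishing combination with
  \<open>v\<close> kills every term except the one of row \<open>i\<close>, so that
  \<open>c i\<close> vanishes and the independence of \<open>J\<close> takes care of the
  rest.\<close>

lemma rows_indep_insert:
  assumes A: "A \<in> carrier_mat m n" and J: "J \<subseteq> {..<m}" and i: "i < m" "i \<notin> J"
    and indep: "rows_indep A J" and v: "v \<in> carrier_vec n"
    and orth: "\<And>j. j \<in> J \<Longrightarrow> row A j \<bullet> v = 0" and nonorth: "row A i \<bullet> v \<noteq> 0"
  shows "rows_indep A (insert i J)"
  unfolding rows_indep_def
proof (intro allI impI)
  fix c
  assume c: "\<forall>j<dim_col A. (\<Sum>l\<in>insert i J. c l * A $$ (l, j)) = 0"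
  have fin: "finite J" using J finite_subset by blast
  have dot: "row A l \<bullet> v = (\<Sum>j<n. A $$ (l, j) * v $ j)" if "l < m" for l
    using A v that by (auto simp: scalar_prod_def atLeast0LessThan intro!: sum.cong)
  have "0 = (\<Sum>j<n. (\<Sum>l\<in>insert i J. c l * A $$ (l, j)) * v $ j)"
    using c A by simp
  also have "\<dots> = (\<Sum>j<n. \<Sum>l\<in>insert i J. c l * (A $$ (l, j) * v $ j))"
    by (simp only: sum_distrib_right mult.assoc)
  also have "\<dots> = (\<Sum>l\<in>insert i J. c l * (\<Sum>j<n. A $$ (l, j) * v $ j))"
    by (subst sum.swap) (simp only: sum_distrib_left)
  also have "\<dots> = (\<Sum>l\<in>insert i J. c l * (row A l \<bullet> v))"
    using J i by (intro sum.cong) (auto simp: dot)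
  also have "\<dots> = c i * (row A i \<bullet> v)"
    using fin i orth by simp
  finally have ci: "c i = 0" using nonorth by simp
  with c fin i have "\<forall>j<dim_col A. (\<Sum>l\<in>J. c l * A $$ (l, j)) = 0" by simp
  with indep ci show "\<forall>l\<in>insert i J. c l = 0" by (auto simp: rows_indep_def)
qed

text \<open>If a solution \<open>y\<close> of the equations indexed by \<open>J\<close> violated some constraint, then on the
  segment from a feasible point to \<open>y\<close> a new constraint would become tight, and its row would be
  independent of those indexed by \<open>J\<close>, against the maximality of \<open>J\<close>.\<close>

lemma exists_indep_rows_feasible:
  fixes A :: "real mat" and b :: "real vec"
  assumes A: "A \<in> carrier_mat m n" and x\<^sub>0: "x\<^sub>0 \<in> carrier_vec n"
    and feas: "\<And>i. i < m \<Longrightarrow> b $ i \<le> row A i \<bullet> x\<^sub>0"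
  obtains J where "J \<subseteq> {..<m}" "rows_indep A J"
    "\<And>y i. y \<in> carrier_vec n \<Longrightarrow> (\<And>j. j \<in> J \<Longrightarrow> row A j \<bullet> y = b $ j) \<Longrightarrow> i < m
       \<Longrightarrow> b $ i \<le> row A i \<bullet> y"
proof -
  define S where "S = {J. J \<subseteq> {..<m} \<and> rows_indep A J \<and>
    (\<exists>x\<in>carrier_vec n. (\<forall>i<m. b $ i \<le> row A i \<bullet> x) \<and> (\<forall>j\<in>J. row A j \<bullet> x = b $ j))}"
  have "finite S" by (rule finite_subset[of _ "Pow {..<m}"]) (auto simp: S_def)
  moreover have "{} \<in> S" using x\<^sub>0 feas by (auto simp: S_def rows_indep_empty)
  ultimately obtain J where J: "J \<in> S" and max: "\<And>K. K \<in> S \<Longrightarrow> J \<subseteq> K \<Longrightarrow> J = K"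
    using finite_has_maximal[of S] by blast
  from J obtain x where Jm: "J \<subseteq> {..<m}" and indep: "rows_indep A J" and x: "x \<in> carrier_vec n"
    and xf: "\<And>i. i < m \<Longrightarrow> b $ i \<le> row A i \<bullet> x" and xt: "\<And>j. j \<in> J \<Longrightarrow> row A j \<bullet> x = b $ j"
    by (auto simp: S_def)
  have "b $ i \<le> row A i \<bullet> y"
    if y: "y \<in> carrier_vec n" and yt: "\<And>j. j \<in> J \<Longrightarrow> row A j \<bullet> y = b $ j" and i: "i < m" for y i
  proof (rule ccontr)
    assume "\<not> b $ i \<le> row A i \<bullet> y"
    define f where "f l = row A l \<bullet> x" for l
    define g where "g l = row A l \<bullet> y" for l
    \<comment> \<open>\<open>K\<close> collects the constraints violated at \<open>y\<close>. On the
      segment from \<open>x\<close> to \<open>y\<close>, constraint \<open>l\<close> in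
      \<open>K\<close> becomes tight at parameter \<open>t l\<close>; the least such parameter, at
      \<open>k\<close>, gives the last feasible point \<open>z\<close>.\<close>
    define K where "K = {l. l < m \<and> g l < b $ l}"
    define t where "t l = (f l - b $ l) / (f l - g l)" for l
    have "finite K" "K \<noteq> {}" using \<open>\<not> _\<close> i by (auto simp: K_def g_def)
    then obtain k where k: "k \<in> K" and kmin: "\<And>l. l \<in> K \<Longrightarrow> t k \<le> t l"
      using arg_min_if_finite(1)[of K t] arg_min_least[of K _ t] by metis
    have gf: "b $ l \<le> f l \<and> f l - g l > 0" if "l \<in> K" for l
      using that xf[of l] by (auto simp: K_def f_def)
    have t0: "0 \<le> t k" using gf[OF k] by (simp add: t_def)
    have t1: "t k \<le> 1" using gf[OF k] k by (simp add: t_def K_def)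
    define z where "z = x + t k \<cdot>\<^sub>v (y - x)"
    have z: "z \<in> carrier_vec n" using x y by (simp add: z_def)
    have dz: "row A l \<bullet> z = f l + t k * (g l - f l)" if "l < m" for l
    proof -
      have r: "row A l \<in> carrier_vec n" using A that by auto
      show ?thesis unfolding z_def f_def g_def
        using r x y by (simp add: scalar_prod_add_distrib[of _ n] scalar_prod_minus_distrib[of _ n])
    qed
    \<comment> \<open>For \<open>l\<close> in \<open>K\<close> the segment has not yet passed
      \<open>t l\<close>. For the others both endpoints satisfy the constraint, hence so does their
      convex combination.\<close>
    have zf: "b $ l \<le> row A l \<bullet> z" if l: "l < m" for l
    proof (cases "l \<in> K")
      case True
      have "t k * (f l - g l) \<le> f l - b $ l"
        using kmin[OF True] gf[OF True] by (simp add: t_def[of l] pos_le_divide_eq)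
      then show ?thesis using dz[OF l] by (simp add: algebra_simps)
    next
      case False
      then have "b $ l \<le> g l" "b $ l \<le> f l" using l xf by (auto simp: K_def f_def)
      then have "(1 - t k) * (b $ l) + t k * (b $ l) \<le> (1 - t k) * f l + t k * g l"
        using t0 t1 by (intro add_mono mult_left_mono) auto
      then show ?thesis using dz[OF l] by (simp add: algebra_simps)
    qed
    have km: "k < m" using k by (simp add: K_def)
    have kJ: "k \<notin> J" using k yt by (auto simp: K_def g_def)
    have "t k * (f k - g k) = f k - b $ k" using gf[OF k] by (simp add: t_def)
    then have zk: "row A k \<bullet> z = b $ k" using dz[OF km] by (simp add: right_diff_distrib)
    have zt: "row A j \<bullet> z = b $ j" if "j \<in> J" for j
      using dz[of j] xt[OF that] yt[OF that] Jm that by (auto simp: f_def g_def)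
    have dyx: "row A l \<bullet> (y - x) = g l - f l" if "l < m" for l
    proof -
      have r: "row A l \<in> carrier_vec n" using A that by auto
      show ?thesis unfolding f_def g_def using scalar_prod_minus_distrib[OF r y x] .
    qed
    \<comment> \<open>The direction \<open>y - x\<close> is the certificate: \<open>x\<close> and
      \<open>y\<close> agree on the rows in \<open>J\<close>, while row \<open>k\<close> strictly
      decreases along the segment.\<close>
    have "rows_indep A (insert k J)"
    proof (rule rows_indep_insert[OF A Jm km kJ indep, of "y - x"])
      show "y - x \<in> carrier_vec n" using x y by simp
      show "row A j \<bullet> (y - x) = 0" if "j \<in> J" for j
        using that Jm dyx[of j] xt yt by (auto simp: f_def g_def)
      show "row A k \<bullet> (y - x) \<noteq> 0" using dyx[OF km] gf[OF k] by simp
    qed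
    then have "insert k J \<in> S" using Jm km z zf zk zt by (auto simp: S_def)
    from max[OF this] kJ show False by blast
  qed
  with Jm indep show thesis by (rule that)
qed

section \<open>Row submatrices\<close>

lemma card_restrict_subset: "J \<subseteq> {..<m} \<Longrightarrow> card {i. i < m \<and> i \<in> J} = card J"
  by (rule arg_cong[of _ _ card]) auto

lemma pick_less:
  assumes "J \<subseteq> {..<m}" "i < card J"
  shows "pick J i < m"
  using assms pick_in_set_le by blast

lemma row_submatrix_carrier:
  "A \<in> carrier_mat m n \<Longrightarrow> J \<subseteq> {..<m} \<Longrightarrow> row_submatrix A J \<in> carrier_mat (card J) n"
  by (auto simp: row_submatrix_def dim_submatrix card_restrict_subset)

lemma row_submatrix_index:
  assumes "A \<in> carrier_mat m n" "J \<subseteq> {..<m}" "i < card J" "j < n"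
  shows "row_submatrix A J $$ (i, j) = A $$ (pick J i, j)"
  using assms unfolding row_submatrix_def
  by (subst submatrix_index) (auto simp: card_restrict_subset pick_UNIV)

lemma row_row_submatrix:
  assumes "A \<in> carrier_mat m n" "J \<subseteq> {..<m}" "i < card J"
  shows "row (row_submatrix A J) i = row A (pick J i)"
  using assms row_submatrix_carrier[OF assms(1,2)] pick_less[OF assms(2,3)]
  by (intro eq_vecI) (auto simp: row_submatrix_index)

lemma subvec_carrier: "b \<in> carrier_vec m \<Longrightarrow> J \<subseteq> {..<m} \<Longrightarrow> subvec b J \<in> carrier_vec (card J)"
  by (auto simp: subvec_def card_restrict_subset)

lemma subvec_index:
  "b \<in> carrier_vec m \<Longrightarrow> J \<subseteq> {..<m} \<Longrightarrow> i < card J \<Longrightarrow> subvec b J $ i = b $ pick J i"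
  by (auto simp: subvec_def card_restrict_subset)

lemma eval_mat_row_submatrix:
  assumes "A \<in> carrier_mat m n" "J \<subseteq> {..<m}"
  shows "row_submatrix (eval_mat A \<delta>) J = eval_mat (row_submatrix A J) \<delta>"
proof -
  have E: "eval_mat A \<delta> \<in> carrier_mat m n" using assms(1) by (simp add: eval_mat_def)
  note dims = row_submatrix_carrier[OF E assms(2)] row_submatrix_carrier[OF assms]
  show ?thesis
  proof (rule eq_matI)
    fix i j assume "i < dim_row (eval_mat (row_submatrix A J) \<delta>)"
      "j < dim_col (eval_mat (row_submatrix A J) \<delta>)"
    then have "i < card J" "j < n" using dims by (auto simp: eval_mat_def)
    then show "row_submatrix (eval_mat A \<delta>) J $$ (i, j) = eval_mat (row_submatrix A J) \<delta> $$ (i, j)"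
      using dims assms(1) pick_less[OF assms(2)]
      by (simp add: row_submatrix_index[OF E assms(2)] row_submatrix_index[OF assms])
        (simp add: eval_mat_def row_submatrix_index[OF assms])
  qed (use dims in \<open>auto simp: eval_mat_def\<close>)
qed

lemma eval_vec_subvec:
  assumes "b \<in> carrier_vec m" "J \<subseteq> {..<m}"
  shows "subvec (eval_vec b \<delta>) J = eval_vec (subvec b J) \<delta>"
  using assms pick_less[OF assms(2)]
  by (intro eq_vecI) (auto simp: subvec_def eval_vec_def card_restrict_subset)

lemma pick_rank:
  assumes "finite J" "i \<in> J"
  shows "card {a \<in> J. a < i} < card J" "pick J (card {a \<in> J. a < i}) = i"
proof -
  show "card {a \<in> J. a < i} < card J" using assms by (intro psubset_card_mono) auto
  show "pick J (card {a \<in> J. a < i}) = i" using assms(2) by (rule pick_card_in_set)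
qed

lemma bij_betw_pick: "finite J \<Longrightarrow> bij_betw (pick J) {..<card J} J"
proof (rule bij_betw_imageI)
  assume fin: "finite J"
  show img: "pick J ` {..<card J} = J"
  proof
    show "pick J ` {..<card J} \<subseteq> J" using pick_in_set_le by blast
    show "J \<subseteq> pick J ` {..<card J}"
    proof
      fix i assume "i \<in> J"
      from pick_rank[OF fin this] show "i \<in> pick J ` {..<card J}" by force
    qed
  qed
  show "inj_on (pick J) {..<card J}" by (rule eq_card_imp_inj_on) (simp_all add: img)
qed

text \<open>Reindexing along the bijection \<open>pick J\<close> turns a vector indexed by positions
  in the submatrix into a coefficient family on \<open>J\<close>. In this form independence can be
  used against kernel vectors supplied by vanishing determinants.\<close>

lemma rows_indep_transpose_kernel:
  assumes A: "A \<in> carrier_mat m n" and J: "J \<subseteq> {..<m}" and indep: "rows_indep A J"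
    and v: "v \<in> carrier_vec (card J)"
    and ker: "\<And>j. j < n \<Longrightarrow> (\<Sum>i<card J. v $ i * row_submatrix A J $$ (i, j)) = 0"
  shows "v = 0\<^sub>v (card J)"
proof -
  have fin: "finite J" using J finite_subset by blast
  define c where "c = (\<lambda>i. v $ the_inv_into {..<card J} (pick J) i)"
  note bij = bij_betw_pick[OF fin]
  have c: "c (pick J i) = v $ i" if "i < card J" for i
    using that bij by (simp add: c_def bij_betw_def the_inv_into_f_f)
  have "(\<Sum>i\<in>J. c i * A $$ (i, j)) = 0" if j: "j < n" for j
  proof -
    have "(\<Sum>i\<in>J. c i * A $$ (i, j)) = (\<Sum>i<card J. c (pick J i) * A $$ (pick J i, j))"
      by (rule sum.reindex_bij_betw[OF bij, symmetric])
    also have "\<dots> = (\<Sum>i<card J. v $ i * row_submatrix A J $$ (i, j))"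
      using j by (intro sum.cong) (auto simp: c row_submatrix_index[OF A J])
    finally show ?thesis using ker[OF j] by simp
  qed
  then have "\<forall>i\<in>J. c i = 0" using indep A unfolding rows_indep_def by auto
  then have "v $ i = 0" if "i < card J" for i
    using that c[OF that] bij bij_betwE by (metis lessThan_iff)
  with v show ?thesis by (intro eq_vecI) auto
qed

text \<open>If there were more than \<open>n\<close> rows, the transposed submatrix could be padded
  with zero rows to a square matrix \<open>B\<close>. It is singular, and a kernel vector is a
  nontrivial dependency of the rows.\<close>

lemma rows_indep_card_le:
  assumes A: "A \<in> carrier_mat m n" and J: "J \<subseteq> {..<m}" and indep: "rows_indep A J"
  shows "card J \<le> n"
proof (rule ccontr)
  let ?k = "card J"
  assume "\<not> ?k \<le> n"
  then have kn: "n < ?k" by simp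
  define B where "B = mat ?k ?k (\<lambda>(i, j). if i < n then row_submatrix A J $$ (j, i) else 0)"
  have B: "B \<in> carrier_mat ?k ?k" by (simp add: B_def)
  \<comment> \<open>This product is row \<open>n\<close> of \<open>B\<close>, the first of the
    padding rows.\<close>
  have "transpose_mat B *\<^sub>v unit_vec ?k n = 0\<^sub>v ?k"
    using kn by (intro eq_vecI) (auto simp: B_def scalar_prod_right_unit[of _ ?k])
  moreover have "unit_vec ?k n \<noteq> (0\<^sub>v ?k :: real vec)" using kn by simp
  ultimately have "det (transpose_mat B) = 0"
    using det_0_iff_vec_prod_zero[of "transpose_mat B" ?k] B by (metis transpose_carrier_mat unit_vec_carrier)
  then have "det B = 0" using det_transpose[OF B] by simp
  then obtain v where v: "v \<in> carrier_vec ?k" and v0: "v \<noteq> 0\<^sub>v ?k" and Bv: "B *\<^sub>v v = 0\<^sub>v ?k"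
    using det_0_iff_vec_prod_zero[OF B] by blast
  have "(\<Sum>i<?k. v $ i * row_submatrix A J $$ (i, j)) = 0" if j: "j < n" for j
  proof -
    have "(\<Sum>i<?k. v $ i * row_submatrix A J $$ (i, j)) = (B *\<^sub>v v) $ j"
      using j kn v by (auto simp: B_def scalar_prod_def atLeast0LessThan mult.commute intro!: sum.cong)
    then show ?thesis using Bv j kn by simp
  qed
  from rows_indep_transpose_kernel[OF A J indep v this] v0 show False by blast
qed

text \<open>For \<open>v\<close> in the kernel of the Gram matrix, the squared norm of
  \<open>transpose_mat M *\<^sub>v v\<close> equals the inner product of \<open>v\<close> with its
  image under the Gram matrix, which is 0. Over the reals this makes \<open>v\<close> a dependency
  of the rows.\<close>

lemma rows_indep_gram_det:
  assumes A: "A \<in> carrier_mat m n" and J: "J \<subseteq> {..<m}" and indep: "rows_indep A J"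
  shows "det (row_submatrix A J * transpose_mat (row_submatrix A J)) \<noteq> 0"
proof
  let ?M = "row_submatrix A J" and ?k = "card J"
  have M: "?M \<in> carrier_mat ?k n" by (rule row_submatrix_carrier[OF A J])
  have T: "transpose_mat ?M \<in> carrier_mat n ?k" using M by simp
  assume "det (?M * transpose_mat ?M) = 0"
  then obtain v where v: "v \<in> carrier_vec ?k" and v0: "v \<noteq> 0\<^sub>v ?k"
    and Gv: "?M * transpose_mat ?M *\<^sub>v v = 0\<^sub>v ?k"
    using det_0_iff_vec_prod_zero[of "?M * transpose_mat ?M" ?k] M by auto
  let ?w = "transpose_mat ?M *\<^sub>v v"
  have w: "?w \<in> carrier_vec n" using T v by simp
  have "?w \<bullet> ?w = v \<bullet> (?M *\<^sub>v ?w)"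
    using transpose_vec_mult_scalar[OF M w v] .
  also have "?M *\<^sub>v ?w = 0\<^sub>v ?k" using Gv assoc_mult_mat_vec[OF M T v] by simp
  also have "v \<bullet> 0\<^sub>v ?k = 0" using v by simp
  finally have "?w = 0\<^sub>v n" using conjugate_square_eq_0_vec[OF w] by simp
  then have w0: "?w $ j = 0" if "j < n" for j using that by simp
  have "(\<Sum>i<?k. v $ i * ?M $$ (i, j)) = 0" if j: "j < n" for j
  proof -
    have "(\<Sum>i<?k. v $ i * ?M $$ (i, j)) = ?w $ j"
      using j M v by (auto simp: scalar_prod_def atLeast0LessThan mult.commute intro!: sum.cong)
    then show ?thesis using w0[OF j] by simp
  qed
  from rows_indep_transpose_kernel[OF A J indep v this] v0 show False by blast
qed

section \<open>Rational functions as quotients\<close>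

text \<open>The fraction need not be in lowest terms. Cross-multiplication together with coprimality
  of the reduced pair gives the divisibilities, from which both the degree bounds and the absence of
  poles are derived.\<close>

lemma rat_num_den_Fract:
  fixes p q :: "real poly"
  assumes q: "q \<noteq> 0"
  shows "rat_num (Fract p q) * q = p * rat_den (Fract p q)"
    and "rat_den (Fract p q) dvd q" and "rat_num (Fract p q) dvd p"
proof -
  let ?r = "Fract p q"
  have "Fract (rat_num ?r) (rat_den ?r) = ?r" by (simp add: rat_num_def rat_den_def)
  then show eq: "rat_num ?r * q = p * rat_den ?r"
    using q by (subst (asm) eq_fract) (auto simp: rat_den_def)
  have cop: "coprime (rat_num ?r) (rat_den ?r)"
    unfolding rat_num_def rat_den_def by (rule coprime_quot_of_fract)
  have "rat_den ?r dvd rat_num ?r * q" unfolding eq by simp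
  then show "rat_den ?r dvd q" using cop by (metis coprime_commute coprime_dvd_mult_right_iff)
  have "rat_num ?r dvd p * rat_den ?r" unfolding eq[symmetric] by simp
  then show "rat_num ?r dvd p" using cop by (metis coprime_dvd_mult_left_iff)
qed

text \<open>The reduced denominator divides \<open>q\<close>, so it cannot vanish where
  \<open>q\<close> does not; the cross-multiplied identity can then be evaluated and divided
  out.\<close>

lemma rat_eval_Fract:
  assumes "poly q \<delta> \<noteq> 0"
  shows "poly (rat_den (Fract p q)) \<delta> \<noteq> 0" "rat_eval (Fract p q) \<delta> = poly p \<delta> / poly q \<delta>"
proof -
  have q: "q \<noteq> 0" using assms by auto
  obtain s where "q = rat_den (Fract p q) * s" using rat_num_den_Fract(2)[OF q] by (rule dvdE)
  then have "poly q \<delta> = poly (rat_den (Fract p q)) \<delta> * poly s \<delta>" by (metis poly_mult)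
  with assms show den: "poly (rat_den (Fract p q)) \<delta> \<noteq> 0" by auto
  have "poly (rat_num (Fract p q)) \<delta> * poly q \<delta> = poly p \<delta> * poly (rat_den (Fract p q)) \<delta>"
    using arg_cong[OF rat_num_den_Fract(1)[OF q], of "\<lambda>r. poly r \<delta>"] by simp
  with den assms show "rat_eval (Fract p q) \<delta> = poly p \<delta> / poly q \<delta>"
    by (simp add: rat_eval_def frac_eq_eq)
qed

lemma degree_rat_num_Fract_le:
  assumes "q \<noteq> 0"
  shows "degree (rat_num (Fract p q)) \<le> degree p"
\<comment> \<open>Every polynomial divides 0, so divisibility bounds the degree only for nonzero
  \<open>p\<close>.\<close>
proof (cases "p = 0")
  case True
  with rat_num_den_Fract(1)[OF assms, of p] assms show ?thesis by simp
next
  case False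
  with rat_num_den_Fract(3)[OF assms, of p] show ?thesis by (rule dvd_imp_degree_le)
qed

section \<open>Signs of polynomials near zero\<close>

text \<open>A nonzero polynomial has finitely many roots, hence none in some interval to the right
  of 0, and by the intermediate value theorem its sign is constant there.\<close>

lemma eventually_poly_nonneg_or_neg:
  fixes p :: "real poly"
  shows "(\<forall>\<^sub>F \<delta> in at_right 0. 0 \<le> poly p \<delta>) \<or> (\<forall>\<^sub>F \<delta> in at_right 0. \<not> 0 \<le> poly p \<delta>)"
proof (cases "p = 0")
  case False
  then have "finite ({x. poly p x = 0} \<inter> {0<..})" by (simp add: poly_roots_finite)
  then obtain e where e: "e > 0" and noroot: "\<And>x. 0 < x \<Longrightarrow> x < e \<Longrightarrow> poly p x \<noteq> 0"
  proof (cases "{x. poly p x = 0} \<inter> {0<..} = {}")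
    case True
    then show thesis by (intro that[of 1]) auto
  next
    case ne: False
    let ?R = "{x. poly p x = 0} \<inter> {0<..}"
    show thesis
    proof (rule that[of "Min ?R"])
      show "0 < Min ?R" using Min_in[OF \<open>finite ?R\<close> ne] by auto
      fix x assume "0 < x" "x < Min ?R"
      then show "poly p x \<noteq> 0" using Min_le[OF \<open>finite ?R\<close>, of x] by auto
    qed
  qed
  have ev: "\<forall>\<^sub>F \<delta> in at_right 0. \<delta> \<in> {0<..<e}" using e by (rule eventually_at_right_real)
  have same: "0 \<le> poly p y" if "x \<in> {0<..<e}" "y \<in> {0<..<e}" "0 \<le> poly p x" for x y
  proof (rule ccontr)
    assume y: "\<not> 0 \<le> poly p y"
    have x: "poly p x > 0" using that noroot[of x] by force
    consider "x < y" | "y < x" using x y by force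
    then show False
    proof cases
      case 1
      with poly_IVT_neg[OF 1 x] y that noroot show False by force
    next
      case 2
      with poly_IVT_pos[OF 2 _ x] y that noroot show False by force
    qed
  qed
  show ?thesis
  proof (cases "\<exists>x\<in>{0<..<e}. 0 \<le> poly p x")
    case True
    with same show ?thesis by (intro disjI1 eventually_mono[OF ev]) blast
  next
    case False
    then show ?thesis by (intro disjI2 eventually_mono[OF ev]) blast
  qed
qed simp

text \<open>A filter need not decide every property. Those it does decide are closed under
  conjunction, which is how sign conditions on polynomials are combined.\<close>

lemma eventually_conj_or_not:
  assumes "eventually P F \<or> (\<forall>\<^sub>F x in F. \<not> P x)" "eventually Q F \<or> (\<forall>\<^sub>F x in F. \<not> Q x)"
  shows "(\<forall>\<^sub>F x in F. P x \<and> Q x) \<or> (\<forall>\<^sub>F x in F. \<not> (P x \<and> Q x))"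
proof -
  consider "eventually P F" "eventually Q F" | "\<forall>\<^sub>F x in F. \<not> P x" | "\<forall>\<^sub>F x in F. \<not> Q x"
    using assms by blast
  then show ?thesis
  proof cases
    case 1
    then show ?thesis by (intro disjI1 eventually_conj)
  next
    case 2
    then show ?thesis by (intro disjI2 eventually_mono[OF 2]) blast
  next
    case 3
    then show ?thesis by (intro disjI2 eventually_mono[OF 3]) blast
  qed
qed

lemma eventually_ball_or_not:
  assumes "finite I" "\<And>i. i \<in> I \<Longrightarrow> eventually (P i) F \<or> (\<forall>\<^sub>F x in F. \<not> P i x)"
  shows "(\<forall>\<^sub>F x in F. \<forall>i\<in>I. P i x) \<or> (\<forall>\<^sub>F x in F. \<not> (\<forall>i\<in>I. P i x))"
proof (cases "\<forall>i\<in>I. eventually (P i) F")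
  case True
  then show ?thesis using assms(1) by (simp add: eventually_ball_finite)
next
  case False
  then obtain i where "i \<in> I" "\<forall>\<^sub>F x in F. \<not> P i x" using assms(2) by blast
  then show ?thesis by (intro disjI2) (auto elim: eventually_mono)
qed

text \<open>Pigeonhole for filters: if no index worked eventually, each would eventually fail, and
  finitely many failures eventually occur together.\<close>

lemma eventually_uniform_choice:
  assumes "finite I" "F \<noteq> bot" "\<forall>\<^sub>F x in F. \<exists>i\<in>I. P i x"
    and "\<And>i. i \<in> I \<Longrightarrow> eventually (P i) F \<or> (\<forall>\<^sub>F x in F. \<not> P i x)"
  shows "\<exists>i\<in>I. eventually (P i) F"
proof (rule ccontr)
  assume "\<not> ?thesis"
  then have "\<forall>i\<in>I. \<forall>\<^sub>F x in F. \<not> P i x" using assms(4) by blast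
  then have "\<forall>\<^sub>F x in F. \<forall>i\<in>I. \<not> P i x" using assms(1) by (simp add: eventually_ball_finite)
  with assms(3) have "\<forall>\<^sub>F x in F. False" by eventually_elim blast
  with assms(2) show False by (simp add: trivial_limit_def)
qed

section \<open>Solutions of polynomial systems\<close>

text \<open>Multiplying by the positive square of \<open>c\<close> clears the denominator whatever
  its sign, so that a constraint on a quotient of polynomials becomes a sign condition on a single
  polynomial.\<close>

lemma le_divide_iff_mult_nonneg:
  fixes a b c :: "'a :: linordered_field"
  assumes "c \<noteq> 0"
  shows "a \<le> b / c \<longleftrightarrow> 0 \<le> (b - a * c) * c"
proof (cases "c > 0")
  case True
  then show ?thesis by (simp only: pos_le_divide_eq zero_le_mult_iff) auto
next
  case False
  with assms have "c < 0" by simp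
  then show ?thesis by (simp only: neg_le_divide_eq zero_le_mult_iff) auto
qed

section \<open>Evaluation at a point and the Cramer solution\<close>

lemma eval_mat_mult:
  "B \<in> carrier_mat r s \<Longrightarrow> C \<in> carrier_mat s t \<Longrightarrow>
    eval_mat (B * C) \<delta> = eval_mat B \<delta> * eval_mat C \<delta>"
  unfolding eval_mat_def by (rule semiring_hom.mat_hom_mult[OF poly_hom.semiring_hom_axioms])

lemma eval_vec_mult_mat_vec:
  "B \<in> carrier_mat r s \<Longrightarrow> v \<in> carrier_vec s \<Longrightarrow>
    eval_vec (B *\<^sub>v v) \<delta> = eval_mat B \<delta> *\<^sub>v eval_vec v \<delta>"
  unfolding eval_mat_def eval_vec_def
  by (rule semiring_hom.mult_mat_vec_hom[OF poly_hom.semiring_hom_axioms])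

lemma det_eval_mat: "det (eval_mat B \<delta>) = poly (det B) \<delta>"
  unfolding eval_mat_def by (rule comm_ring_hom.hom_det[OF poly_hom.comm_ring_hom_axioms])

lemma eval_mat_transpose: "eval_mat (transpose_mat B) \<delta> = transpose_mat (eval_mat B \<delta>)"
  unfolding eval_mat_def by (rule eq_matI) simp_all

text \<open>With \<open>G\<close> the Gram matrix, this is \<open>det G\<close> times the
  pseudoinverse solution wherever \<open>G\<close> is invertible. The adjugate replaces the inverse
  so that the entries stay polynomials.\<close>

definition gram_numerator :: "real poly mat \<Rightarrow> real poly vec \<Rightarrow> real poly vec" where
  "gram_numerator M c = transpose_mat M *\<^sub>v (adj_mat (M * transpose_mat M) *\<^sub>v c)"

lemma gram_numerator_carrier:
  "M \<in> carrier_mat k n \<Longrightarrow> gram_numerator M c \<in> carrier_vec n"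
  unfolding gram_numerator_def by (rule carrier_vecI) simp

text \<open>Evaluating the adjugate identity and dividing by the nonzero determinant gives the
  inverse \<open>H\<close> of the evaluated Gram matrix. Both claims then follow from the form of
  the pseudoinverse as transpose times \<open>H\<close>.\<close>

lemma eval_gram_solution:
  assumes M: "M \<in> carrier_mat k n" and c: "c \<in> carrier_vec k"
    and d: "poly (det (M * transpose_mat M)) \<delta> \<noteq> 0"
  defines "x \<equiv> (1 / poly (det (M * transpose_mat M)) \<delta>) \<cdot>\<^sub>v eval_vec (gram_numerator M c) \<delta>"
  shows "pseudoinverse (eval_mat M \<delta>) *\<^sub>v eval_vec c \<delta> = x"
    and "eval_mat M \<delta> *\<^sub>v x = eval_vec c \<delta>"
proof -
  let ?T = "transpose_mat M"
  let ?G = "M * ?T"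
  let ?Q = "adj_mat ?G"
  let ?d = "poly (det ?G) \<delta>"
  let ?E = "eval_mat M \<delta>" and ?q = "eval_mat ?Q \<delta>" and ?c = "eval_vec c \<delta>"
  have T: "?T \<in> carrier_mat n k" and G: "?G \<in> carrier_mat k k" using M by auto
  note Q = adj_mat[OF G]
  have E: "?E \<in> carrier_mat k n" and q: "?q \<in> carrier_mat k k" and ec: "?c \<in> carrier_vec k"
    using M Q(1) c by (auto simp: eval_mat_def eval_vec_def)
  have Etc: "transpose_mat ?E \<in> carrier_mat n k" using E by simp
  have "?E * transpose_mat ?E * ?q = eval_mat (?G * ?Q) \<delta>"
    by (simp only: eval_mat_mult[OF G Q(1)] eval_mat_mult[OF M T] eval_mat_transpose)
  also have "\<dots> = ?d \<cdot>\<^sub>m 1\<^sub>m k"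
    unfolding Q(2) eval_mat_def by (rule eq_matI) auto
  finally have Eq: "?E * transpose_mat ?E * ?q = ?d \<cdot>\<^sub>m 1\<^sub>m k" .
  define H where "H = (1 / ?d) \<cdot>\<^sub>m ?q"
  have H: "H \<in> carrier_mat k k" using q by (simp add: H_def)
  have "?E * transpose_mat ?E * H = (1 / ?d) \<cdot>\<^sub>m (?d \<cdot>\<^sub>m 1\<^sub>m k)"
    unfolding H_def Eq[symmetric] using E q by (intro mult_smult_distrib) auto
  also have "\<dots> = 1\<^sub>m k" using d by (intro eq_matI) auto
  finally have inv: "?E * transpose_mat ?E * H = 1\<^sub>m k" .
  have "eval_vec (gram_numerator M c) \<delta> = transpose_mat ?E *\<^sub>v (?q *\<^sub>v ?c)"
    unfolding gram_numerator_def
    by (simp only: eval_vec_mult_mat_vec[OF T mult_mat_vec_carrier[OF Q(1) c]]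
        eval_vec_mult_mat_vec[OF Q(1) c] eval_mat_transpose)
  moreover have smult: "H *\<^sub>v ?c = (1 / ?d) \<cdot>\<^sub>v (?q *\<^sub>v ?c)"
    unfolding H_def using q ec by (intro eq_vecI) auto
  ultimately have "x = transpose_mat ?E *\<^sub>v (H *\<^sub>v ?c)"
    unfolding x_def smult by (simp only: mult_mat_vec[OF Etc mult_mat_vec_carrier[OF q ec]])
  then have x: "x = transpose_mat ?E * H *\<^sub>v ?c"
    using assoc_mult_mat_vec[OF Etc H ec] by simp
  show "pseudoinverse ?E *\<^sub>v ?c = x"
    unfolding x using pseudoinverse_eqI[OF is_pseudoinverse_gram[OF E H inv]] by simp
  have "?E *\<^sub>v x = ?E * (transpose_mat ?E * H) *\<^sub>v ?c"
    unfolding x using Etc H by (intro assoc_mult_mat_vec[symmetric, OF E _ ec]) auto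
  also have "?E * (transpose_mat ?E * H) = 1\<^sub>m k" using assoc_mult_mat[OF E Etc H] inv by simp
  finally show "?E *\<^sub>v x = ?c" using ec by simp
qed

section \<open>Degree bounds for the Cramer solution\<close>

lemma degree_mult_le_add:
  fixes p q :: "'a :: comm_semiring_0 poly"
  shows "degree p \<le> a \<Longrightarrow> degree q \<le> b \<Longrightarrow> degree (p * q) \<le> a + b"
  using degree_mult_le[of p q] by linarith

lemma degree_mult_mat_vec_le:
  fixes B :: "real poly mat"
  assumes "B \<in> carrier_mat r s" "v \<in> carrier_vec s" "i < r"
    and "\<And>j. j < s \<Longrightarrow> degree (B $$ (i, j)) + degree (v $ j) \<le> a"
  shows "degree ((B *\<^sub>v v) $ i) \<le> a"
proof -
  have "(B *\<^sub>v v) $ i = (\<Sum>j<s. B $$ (i, j) * v $ j)"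
    using assms(1-3) by (simp add: scalar_prod_def atLeast0LessThan)
  also have "degree \<dots> \<le> a"
    by (rule degree_sum_le) (use assms(4) in \<open>auto intro: order_trans[OF degree_mult_le]\<close>)
  finally show ?thesis .
qed

lemma degree_gram_entry_le:
  fixes M :: "real poly mat"
  assumes M: "M \<in> carrier_mat k n" and ij: "i < k" "j < k"
    and dM: "\<And>i j. i < k \<Longrightarrow> j < n \<Longrightarrow> degree (M $$ (i, j)) \<le> D"
  shows "degree ((M * transpose_mat M) $$ (i, j)) \<le> 2 * D"
  using M ij dM by (auto simp: scalar_prod_def mult_2 intro!: degree_sum_le degree_mult_le_add)

lemma degree_gram_det_le:
  fixes M :: "real poly mat"
  assumes M: "M \<in> carrier_mat k n"
    and dM: "\<And>i j. i < k \<Longrightarrow> j < n \<Longrightarrow> degree (M $$ (i, j)) \<le> D"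
  shows "degree (det (M * transpose_mat M)) \<le> 2 * k * D"
proof -
  have "degree (det (M * transpose_mat M)) \<le> 2 * D * k"
    by (rule degree_det_le[OF degree_gram_entry_le[OF M _ _ dM]]) (use M in auto)
  then show ?thesis by (simp add: ac_simps)
qed

text \<open>The cofactors are, up to sign, minors of size \<open>k - 1\<close> with entries of
  degree at most \<open>2 * D\<close>; the factors from \<open>c\<close> and from the transpose of
  \<open>M\<close> contribute \<open>D\<close> each, which restores the count to
  \<open>2 * k * D\<close>.\<close>

lemma degree_gram_numerator_le:
  assumes M: "M \<in> carrier_mat k n" and c: "c \<in> carrier_vec k"
    and dM: "\<And>i j. i < k \<Longrightarrow> j < n \<Longrightarrow> degree (M $$ (i, j)) \<le> D"
    and dc: "\<And>i. i < k \<Longrightarrow> degree (c $ i) \<le> D"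
    and j: "j < n"
  shows "degree (gram_numerator M c $ j) \<le> 2 * k * D"
proof -
  let ?G = "M * transpose_mat M"
  have G: "?G \<in> carrier_mat k k" using M by auto
  note dG = degree_gram_entry_le[OF M _ _ dM]
  note Q = adj_mat(1)[OF G]
  have dQ: "degree (adj_mat ?G $$ (i, j)) \<le> 2 * D * (k - 1)" if ij: "i < k" "j < k" for i j
  proof -
    have del: "mat_delete ?G j i \<in> carrier_mat (k - 1) (k - 1)"
      using mat_delete_carrier[OF G] .
    have "degree (det (mat_delete ?G j i)) \<le> 2 * D * (k - 1)"
    proof (rule degree_det_le[OF _ del])
      fix i' j' assume "i' < k - 1" "j' < k - 1"
      then show "degree (mat_delete ?G j i $$ (i', j')) \<le> 2 * D"
        using G ij dG by (auto simp: mat_delete_def)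
    qed
    then have "degree (cofactor ?G j i) \<le> 0 + 2 * D * (k - 1)"
      unfolding cofactor_def
      by (intro degree_mult_le_add) (auto simp: degree_power_eq)
    moreover have "adj_mat ?G $$ (i, j) = cofactor ?G j i" using ij M by (simp add: adj_mat_def)
    ultimately show ?thesis by simp
  qed
  let ?v = "adj_mat ?G *\<^sub>v c"
  have v: "?v \<in> carrier_vec k" using Q c by simp
  have dv: "degree (?v $ i) \<le> 2 * D * (k - 1) + D" if "i < k" for i
    using that by (intro degree_mult_mat_vec_le[OF Q c] add_mono dQ dc)
  show "degree (gram_numerator M c $ j) \<le> 2 * k * D"
    unfolding gram_numerator_def
  proof (rule degree_mult_mat_vec_le[OF _ v j])
    show "transpose_mat M \<in> carrier_mat n k" using M by simp
    fix i assume i: "i < k"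
    have "degree (transpose_mat M $$ (j, i)) + degree (?v $ i) \<le> D + (2 * D * (k - 1) + D)"
      using i j M by (intro add_mono dv) (auto simp: dM)
    \<comment> \<open>The index \<open>i\<close> forces \<open>k\<close> to be positive, so the
      subtraction in \<open>k - 1\<close> is not truncated.\<close>
    also have "\<dots> = 2 * k * D" using i by (cases k) (auto simp: algebra_simps)
    finally show "degree (transpose_mat M $$ (j, i)) + degree (?v $ i) \<le> 2 * k * D" .
  qed
qed

section \<open>One constraint set for all small parameters\<close>

theorem theorem12:
  fixes A :: "real poly mat" and b :: "real poly vec" and m n D :: nat
  assumes "A \<in> carrier_mat m n"
    and "b \<in> carrier_vec m"
    and "\<forall>i<m. \<forall>j<n. degree (A $$ (i, j)) \<le> D"
    and "\<forall>i<m. degree (b $ i) \<le> D"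
    and "\<exists>\<epsilon>>0. \<forall>\<delta>\<in>{0<..<\<epsilon>}. \<exists>x\<^sub>1\<in>carrier_vec n. eval_mat A \<delta> *\<^sub>v x\<^sub>1 \<ge> eval_vec b \<delta>"
  shows "\<exists>x\<in>carrier_vec n. \<exists>J\<subseteq>{..<m}. \<exists>\<epsilon>'>0.
           (\<forall>\<delta>\<in>{0<..<\<epsilon>'}.
              (\<forall>j<n. poly (rat_den (x $ j)) \<delta> \<noteq> 0) \<and>
              eval_mat A \<delta> *\<^sub>v rat_eval_vec x \<delta> \<ge> eval_vec b \<delta> \<and>
              rat_eval_vec x \<delta> =
                pseudoinverse (row_submatrix (eval_mat A \<delta>) J) *\<^sub>v subvec (eval_vec b \<delta>) J) \<and>
           (\<forall>j<n. degree (rat_num (x $ j)) \<le> 2 * n * D) \<and>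
           degree (Lcm ((\<lambda>j. rat_den (x $ j)) ` {..<n})) \<le> 2 * n * D"
proof -
  note A = assms(1) and b = assms(2)
  define M where "M J = row_submatrix A J" for J
  define c where "c J = subvec b J" for J
  define d where "d J = det (M J * transpose_mat (M J))" for J
  define N where "N J = gram_numerator (M J) (c J)" for J
  \<comment> \<open>Constraint \<open>i\<close> at the point \<open>N J / d J\<close>, with the
    denominator cleared by multiplying with the square of \<open>d J\<close>.\<close>
  define p where "p J i = (row A i \<bullet> N J - b $ i * d J) * d J" for J i
  define P where "P J \<delta> \<longleftrightarrow> poly (d J) \<delta> \<noteq> 0 \<and> (\<forall>i\<in>{..<m}. 0 \<le> poly (p J i) \<delta>)" for J \<delta>
  \<comment> \<open>Independence of the rows may vary with \<delta>, so it is not part of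
    \<open>I\<close>; \<open>P\<close> asks for a nonzero Gram determinant instead. The cardinality
    bound later turns \<open>card J\<close> into \<open>n\<close> in the degrees.\<close>
  define I where "I = {J. J \<subseteq> {..<m} \<and> card J \<le> n}"
  define X where "X J \<delta> = (1 / poly (d J) \<delta>) \<cdot>\<^sub>v eval_vec (N J) \<delta>" for J \<delta>
  have Mc: "M J \<in> carrier_mat (card J) n" and cc: "c J \<in> carrier_vec (card J)"
    and Nc: "N J \<in> carrier_vec n" if "J \<in> I" for J
    using that row_submatrix_carrier[OF A] subvec_carrier[OF b]
    by (auto simp: I_def M_def c_def N_def intro!: gram_numerator_carrier)
  have Ev: "eval_mat A \<delta> \<in> carrier_mat m n" and ev: "eval_vec b \<delta> \<in> carrier_vec m" for \<delta>
    using A b by (auto simp: eval_mat_def eval_vec_def)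
  have Xc: "X J \<delta> \<in> carrier_vec n" if "J \<in> I" for J \<delta>
    using Nc[OF that] by (simp add: X_def eval_vec_def)
  have feasible_iff: "eval_mat A \<delta> *\<^sub>v X J \<delta> \<ge> eval_vec b \<delta> \<longleftrightarrow> (\<forall>i\<in>{..<m}. 0 \<le> poly (p J i) \<delta>)"
    if J: "J \<in> I" and dJ: "poly (d J) \<delta> \<noteq> 0" for J \<delta>
  proof -
    have "eval_vec b \<delta> $ i \<le> (eval_mat A \<delta> *\<^sub>v X J \<delta>) $ i \<longleftrightarrow> 0 \<le> poly (p J i) \<delta>" if i: "i < m" for i
    proof -
      let ?s = "poly (row A i \<bullet> N J) \<delta>" and ?b = "poly (b $ i) \<delta>" and ?d = "poly (d J) \<delta>"
      have "(eval_mat A \<delta> *\<^sub>v X J \<delta>) $ i = (1 / ?d) * (eval_mat A \<delta> *\<^sub>v eval_vec (N J) \<delta>) $ i"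
        unfolding X_def using i Ev Nc[OF J]
        by (subst mult_mat_vec[OF Ev]) (auto simp: eval_vec_def eval_mat_def)
      also have "eval_mat A \<delta> *\<^sub>v eval_vec (N J) \<delta> = eval_vec (A *\<^sub>v N J) \<delta>"
        by (rule eval_vec_mult_mat_vec[OF A Nc[OF J], symmetric])
      also have "eval_vec (A *\<^sub>v N J) \<delta> $ i = ?s" using i A by (simp add: eval_vec_def)
      finally have s: "(eval_mat A \<delta> *\<^sub>v X J \<delta>) $ i = ?s / ?d" by simp
      show ?thesis
        using le_divide_iff_mult_nonneg[OF dJ, of ?b ?s] s i b by (simp add: p_def eval_vec_def)
    qed
    then show ?thesis using Ev[of \<delta>] ev[of \<delta>] by (auto simp: less_eq_vec_def)
  qed
  have "finite I" by (rule finite_subset[of _ "Pow {..<m}"]) (auto simp: I_def)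
  moreover have "\<forall>\<^sub>F \<delta> in at_right 0. \<exists>J\<in>I. P J \<delta>"
  proof -
    from assms(5) obtain e where e: "e > 0" and
      sol: "\<And>\<delta>. \<delta> \<in> {0<..<e} \<Longrightarrow> \<exists>x\<^sub>1\<in>carrier_vec n. eval_mat A \<delta> *\<^sub>v x\<^sub>1 \<ge> eval_vec b \<delta>"
      by blast
    have "\<exists>J\<in>I. P J \<delta>" if "\<delta> \<in> {0<..<e}" for \<delta>
    proof -
      from sol[OF that] obtain x where x: "x \<in> carrier_vec n"
        and xf: "eval_mat A \<delta> *\<^sub>v x \<ge> eval_vec b \<delta>" by blast
      have "eval_vec b \<delta> $ i \<le> row (eval_mat A \<delta>) i \<bullet> x" if "i < m" for i
        using xf that Ev[of \<delta>] ev[of \<delta>] by (auto simp: less_eq_vec_def)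
      from exists_indep_rows_feasible[OF Ev x this] obtain J where J: "J \<subseteq> {..<m}"
        and indep: "rows_indep (eval_mat A \<delta>) J"
        and feas: "\<And>y i. y \<in> carrier_vec n \<Longrightarrow>
          (\<And>j. j \<in> J \<Longrightarrow> row (eval_mat A \<delta>) j \<bullet> y = eval_vec b \<delta> $ j) \<Longrightarrow> i < m \<Longrightarrow>
          eval_vec b \<delta> $ i \<le> row (eval_mat A \<delta>) i \<bullet> y" by blast
      have JI: "J \<in> I" using J rows_indep_card_le[OF Ev J indep] by (simp add: I_def)
      have fin: "finite J" using J finite_subset by blast
      have Mt: "transpose_mat (M J) \<in> carrier_mat n (card J)" using Mc[OF JI] by simp
      have "det (eval_mat (M J) \<delta> * transpose_mat (eval_mat (M J) \<delta>)) \<noteq> 0"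
        using rows_indep_gram_det[OF Ev J indep] by (simp add: eval_mat_row_submatrix[OF A J] M_def)
      also have "eval_mat (M J) \<delta> * transpose_mat (eval_mat (M J) \<delta>)
          = eval_mat (M J * transpose_mat (M J)) \<delta>"
        by (simp only: eval_mat_mult[OF Mc[OF JI] Mt] eval_mat_transpose)
      finally have dJ: "poly (d J) \<delta> \<noteq> 0" by (simp add: d_def det_eval_mat)
      have "eval_mat (M J) \<delta> *\<^sub>v X J \<delta> = eval_vec (c J) \<delta>"
        using eval_gram_solution(2)[OF Mc[OF JI] cc[OF JI], of \<delta>] dJ
        by (simp add: X_def d_def N_def)
      then have sys: "row_submatrix (eval_mat A \<delta>) J *\<^sub>v X J \<delta> = subvec (eval_vec b \<delta>) J"
        by (simp add: M_def c_def eval_mat_row_submatrix[OF A J] eval_vec_subvec[OF b J])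
      have tight: "row (eval_mat A \<delta>) j \<bullet> X J \<delta> = eval_vec b \<delta> $ j" if "j \<in> J" for j
      proof -
        from pick_rank[OF fin that] obtain i where i: "i < card J" "pick J i = j" by blast
        have "row (eval_mat A \<delta>) j \<bullet> X J \<delta> = (row_submatrix (eval_mat A \<delta>) J *\<^sub>v X J \<delta>) $ i"
          using i row_submatrix_carrier[OF Ev[of \<delta>] J] row_row_submatrix[OF Ev[of \<delta>] J i(1)] by simp
        then show ?thesis using i subvec_index[OF ev[of \<delta>] J i(1)] by (simp add: sys)
      qed
      \<comment> \<open>By \<open>tight\<close>, \<open>X J \<delta>\<close> solves the equations
        indexed by \<open>J\<close>, and for this \<open>J\<close> every such solution is
        feasible.\<close>
      have "eval_mat A \<delta> *\<^sub>v X J \<delta> \<ge> eval_vec b \<delta>"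
        using feas[OF Xc[OF JI] tight] Ev[of \<delta>] ev[of \<delta>] by (auto simp: less_eq_vec_def)
      with feasible_iff[OF JI dJ] dJ JI show ?thesis by (auto simp: P_def)
    qed
    then show ?thesis using eventually_at_right_real[OF e] by (rule eventually_mono[rotated])
  qed
  moreover have "eventually (P J) (at_right 0) \<or> (\<forall>\<^sub>F \<delta> in at_right 0. \<not> P J \<delta>)" if "J \<in> I" for J
    unfolding P_def
  proof (intro eventually_conj_or_not eventually_ball_or_not eventually_poly_nonneg_or_neg)
    show "(\<forall>\<^sub>F \<delta> in at_right 0. poly (d J) \<delta> \<noteq> 0) \<or> (\<forall>\<^sub>F \<delta> in at_right 0. \<not> poly (d J) \<delta> \<noteq> 0)"
    proof -
      \<comment> \<open>Vanishing is rewritten as nonnegativity of minus a square, so that the sign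
        dichotomy applies to it too.\<close>
      have "poly (d J) \<delta> = 0 \<longleftrightarrow> 0 \<le> poly (- (d J * d J)) \<delta>" for \<delta>
        using not_square_less_zero[of "poly (d J) \<delta>"] by (auto simp: mult_le_0_iff)
      then show ?thesis using eventually_poly_nonneg_or_neg[of "- (d J * d J)"] by auto
    qed
  qed simp
  ultimately obtain J where J: "J \<in> I" and PJ: "eventually (P J) (at_right 0)"
    using eventually_uniform_choice[of I "at_right (0::real)" P] by (auto simp: trivial_limit_at_right_real)
  then obtain e where e: "e > 0" and Pe: "\<And>\<delta>. \<delta> \<in> {0<..<e} \<Longrightarrow> P J \<delta>"
    by (auto simp: eventually_at_right_field)
  have Jm: "J \<subseteq> {..<m}" and Jn: "card J \<le> n" using J by (auto simp: I_def)
  have d0: "d J \<noteq> 0" using Pe[of "e / 2"] e by (auto simp: P_def)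
  define x where "x = vec n (\<lambda>j. Fract (N J $ j) (d J))"
  have dM: "degree (M J $$ (i, j)) \<le> D" if "i < card J" "j < n" for i j
    using that assms(3) pick_less[OF Jm] by (simp add: M_def row_submatrix_index[OF A Jm])
  have dc: "degree (c J $ i) \<le> D" if "i < card J" for i
    using that assms(4) pick_less[OF Jm] by (simp add: c_def subvec_index[OF b Jm])
  have bound: "2 * card J * D \<le> 2 * n * D" using Jn by simp
  have deg_num: "degree (rat_num (x $ j)) \<le> 2 * n * D" if "j < n" for j
  proof -
    have "degree (rat_num (x $ j)) \<le> degree (N J $ j)"
      using degree_rat_num_Fract_le[OF d0] that by (simp add: x_def)
    also have "\<dots> \<le> 2 * card J * D"
      unfolding N_def by (rule degree_gram_numerator_le[OF Mc[OF J] cc[OF J] dM dc that])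
    finally show ?thesis using bound by (rule order_trans)
  qed
  \<comment> \<open>All entries of \<open>x\<close> are fractions over \<open>d J\<close>, so each
    reduced denominator divides it. The least common multiple thus costs no more than a single
    denominator.\<close>
  have "Lcm ((\<lambda>j. rat_den (x $ j)) ` {..<n}) dvd d J"
    by (rule Lcm_least) (auto simp: x_def rat_num_den_Fract(2)[OF d0])
  then have "degree (Lcm ((\<lambda>j. rat_den (x $ j)) ` {..<n})) \<le> degree (d J)"
    using d0 by (rule dvd_imp_degree_le)
  also have "\<dots> \<le> 2 * card J * D"
    unfolding d_def by (rule degree_gram_det_le[OF Mc[OF J] dM])
  also note bound
  finally have deg_den: "degree (Lcm ((\<lambda>j. rat_den (x $ j)) ` {..<n})) \<le> 2 * n * D" .
  have eval: "(\<forall>j<n. poly (rat_den (x $ j)) \<delta> \<noteq> 0) \<and>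
      eval_mat A \<delta> *\<^sub>v rat_eval_vec x \<delta> \<ge> eval_vec b \<delta> \<and>
      rat_eval_vec x \<delta> = pseudoinverse (row_submatrix (eval_mat A \<delta>) J) *\<^sub>v subvec (eval_vec b \<delta>) J"
    if "\<delta> \<in> {0<..<e}" for \<delta>
  proof -
    have dJ: "poly (d J) \<delta> \<noteq> 0" and feas: "eval_mat A \<delta> *\<^sub>v X J \<delta> \<ge> eval_vec b \<delta>"
      using Pe[OF that] feasible_iff[OF J] by (auto simp: P_def)
    have xX: "rat_eval_vec x \<delta> = X J \<delta>"
      using Nc[OF J] dJ
      by (intro eq_vecI) (auto simp: rat_eval_vec_def x_def X_def eval_vec_def rat_eval_Fract(2))
    have "pseudoinverse (eval_mat (M J) \<delta>) *\<^sub>v eval_vec (c J) \<delta> = X J \<delta>"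
      using eval_gram_solution(1)[OF Mc[OF J] cc[OF J], of \<delta>] dJ by (simp add: X_def d_def N_def)
    then have "pseudoinverse (row_submatrix (eval_mat A \<delta>) J) *\<^sub>v subvec (eval_vec b \<delta>) J = X J \<delta>"
      by (simp add: M_def c_def eval_mat_row_submatrix[OF A Jm] eval_vec_subvec[OF b Jm])
    with xX feas dJ show ?thesis by (auto simp: x_def rat_eval_Fract(1))
  qed
  have "x \<in> carrier_vec n" by (simp add: x_def)
  with Jm e eval deg_num deg_den show ?thesis by blast
qed

end
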